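(* Let $k$ be a commutative ring, let $S$ be a (finite) $\mathscr R$-trivial semigroup satisfying $s\in sS$ for all $s\in S$, and let $c\colon kS\to k\Lambda(S)$ be the $k$-linear extension of the homomorphism $c\colon S\to\Lambda(S)$, $c(s)=Ss^\omega$. If $\mathfrak J=\ker(c\colon kS\to k\Lambda(S))$, then $\mathfrak J^{n+2}=0$, where $n$ is the length of the longest $\leq_{\mathscr R}$-chain in $S$.
   Context: All semigroups are finite. $S^1$ denotes $S$ with an adjoined identity. Write $s\leq_{\mathscr R}t$ iff $sS^1\subseteq tS^1$; $S$ is $\mathscr R$-trivial if $\leq_{\mathscr R}$ is a partial order. A chain $s_0<_{\mathscr R}s_1<_{\mathscr R}\cdots<_{\mathscr R}s_n$ has length $n$. For $s\in S$, $s^\omega$ denotes the unique idempotent power of $s$. For $S$ $\mathscr R$-trivial, $\Lambda(S)$ is the set of left ideals of the form $Se$ with $e\in S$ idempotent; it is closed under intersection, hence is a meet semilattice (a semigroup under intersection), and $c\colon S\to\Lambda(S)$, $c(s)=Ss^\omega$, is a surjective semigroup homomorphism. $kS$ and $k\Lambda(S)$ denote semigroup algebras. *)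

theory Defs
  imports "HOL-Library.Poly_Mapping"
begin

section \<open>Finite \<open>\<R>\<close>-trivial semigroups\<close>

definition right_ideal1 :: "'s::semigroup_mult \<Rightarrow> 's set"
  where "right_ideal1 s = insert s (range ((*) s))"

definition R_le :: "'s::semigroup_mult \<Rightarrow> 's \<Rightarrow> bool"
  where "R_le s t \<longleftrightarrow> right_ideal1 s \<subseteq> right_ideal1 t"

definition R_trivial :: "'s::semigroup_mult itself \<Rightarrow> bool"
  where "R_trivial _ \<longleftrightarrow> partial_order_on UNIV {(s, t :: 's). R_le s t}"

definition R_less :: "'s::semigroup_mult \<Rightarrow> 's \<Rightarrow> bool"
  where "R_less s t \<longleftrightarrow> R_le s t \<and> s \<noteq> t"

definition R_chain :: "(nat \<Rightarrow> 's::semigroup_mult) \<Rightarrow> nat \<Rightarrow> bool"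
  where "R_chain s n \<longleftrightarrow> (\<forall>i<n. R_less (s i) (s (Suc i)))"

definition idempotent :: "'s::semigroup_mult \<Rightarrow> bool"
  where "idempotent e \<longleftrightarrow> e * e = e"

text \<open>A semigroup need not have an identity, so powers start at exponent one:
  \<open>pow_Suc s n\<close> is \<open>s\<^bsup>n+1\<^esup>\<close>.\<close>

primrec pow_Suc :: "'s::semigroup_mult \<Rightarrow> nat \<Rightarrow> 's"
  where
    "pow_Suc s 0 = s"
  | "pow_Suc s (Suc n) = pow_Suc s n * s"

definition omega :: "'s::semigroup_mult \<Rightarrow> 's"
  where "omega s = (THE e. idempotent e \<and> e \<in> range (pow_Suc s))"

lemma pow_Suc_mult: "pow_Suc s m * pow_Suc s n = pow_Suc s (Suc (m + n))"
  by (induction n) (simp_all flip: mult.assoc)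

lemma pow_Suc_pow_Suc: "pow_Suc (pow_Suc s m) n = pow_Suc s (m * n + m + n)"
proof (induction n)
  case (Suc n)
  then show ?case by (simp add: pow_Suc_mult algebra_simps)
qed simp

lemma idempotent_pow_Suc: "idempotent e \<Longrightarrow> pow_Suc e n = e"
  by (induction n) (simp_all add: idempotent_def)

text \<open>In a finite semigroup the description defining \<^const>\<open>omega\<close> is proper.\<close>

lemma ex1_idempotent_power:
  fixes s :: "'s::{finite, semigroup_mult}"
  shows "\<exists>!e. idempotent e \<and> e \<in> range (pow_Suc s)"
proof -
  have "\<not> inj (pow_Suc s)"
    using finite_imageD[of "pow_Suc s" UNIV] by auto
  then obtain i j where "i < j" and ij: "pow_Suc s i = pow_Suc s j"
    by (metis injI linorder_neqE_nat)
  then obtain p where p: "j = Suc (i + p)"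
    by (auto dest: less_imp_Suc_add)
  have step: "pow_Suc s (i + d + Suc p) = pow_Suc s (i + d)" for d
  proof (cases d)
    case (Suc d')
    have "pow_Suc s (i + d + Suc p) = pow_Suc s j * pow_Suc s d'"
      by (simp add: pow_Suc_mult Suc p algebra_simps del: pow_Suc.simps)
    also have "\<dots> = pow_Suc s (i + d)"
      by (simp add: pow_Suc_mult Suc del: pow_Suc.simps flip: ij)
    finally show ?thesis .
  qed (use ij p in simp)
  have steps: "pow_Suc s (i + d + k * Suc p) = pow_Suc s (i + d)" for d k
  proof (induction k)
    case (Suc k)
    then show ?case using step[of "d + k * Suc p"] by (simp add: algebra_simps del: pow_Suc.simps)
  qed simp
  define m where "m = Suc i * p + i"
  have "pow_Suc s m * pow_Suc s m = pow_Suc s (i + Suc i * p + Suc i * Suc p)"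
    by (simp add: pow_Suc_mult m_def algebra_simps del: pow_Suc.simps)
  also have "\<dots> = pow_Suc s m"
    unfolding steps by (simp add: m_def algebra_simps del: pow_Suc.simps)
  finally have "idempotent (pow_Suc s m)"
    by (simp add: idempotent_def)
  moreover have "pow_Suc s a = pow_Suc s b"
    if "idempotent (pow_Suc s a)" "idempotent (pow_Suc s b)" for a b
    using that idempotent_pow_Suc[of "pow_Suc s a" b] idempotent_pow_Suc[of "pow_Suc s b" a]
    by (simp add: pow_Suc_pow_Suc algebra_simps del: pow_Suc.simps)
  ultimately show ?thesis by blast
qed

text \<open>The semilattice \<open>\<Lambda>(S)\<close> of left ideals \<open>Se\<close> with \<open>e\<close> idempotent, and the map
  \<open>c(s) = Ss\<^sup>\<omega>\<close>.\<close>

definition left_ideal :: "'s::semigroup_mult \<Rightarrow> 's set"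
  where "left_ideal e = range (\<lambda>s. s * e)"

definition Lambda :: "'s::semigroup_mult set set"
  where "Lambda = {left_ideal e | e. idempotent e}"

definition c_map :: "'s::semigroup_mult \<Rightarrow> 's set"
  where "c_map s = left_ideal (omega s)"

lemma c_map_in_Lambda: "c_map s \<in> Lambda" for s :: "'s::{finite, semigroup_mult}"
  using theI'[OF ex1_idempotent_power[of s]]
  by (auto simp: c_map_def Lambda_def omega_def)


section \<open>Semigroup algebras\<close>

text \<open>The free module \<open>kS\<close> is the type \<open>'s \<Rightarrow>\<^sub>0 'k\<close> of finitely supported functions, with
  \<^term>\<open>Poly_Mapping.single s a\<close> playing the role of \<open>a s\<close>. The library product on this type
  is for additively written index monoids, so the product of \<open>kS\<close> is defined separately.\<close>

definition alg_mult ::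
    "('s::semigroup_mult \<Rightarrow>\<^sub>0 'k::comm_ring) \<Rightarrow> ('s \<Rightarrow>\<^sub>0 'k) \<Rightarrow> ('s \<Rightarrow>\<^sub>0 'k)"
  where "alg_mult f g =
    (\<Sum>s\<in>Poly_Mapping.keys f. \<Sum>t\<in>Poly_Mapping.keys g.
      Poly_Mapping.single (s * t) (Poly_Mapping.lookup f s * Poly_Mapping.lookup g t))"

definition linear_ext :: "('a \<Rightarrow> 'b) \<Rightarrow> ('a \<Rightarrow>\<^sub>0 'k::comm_ring) \<Rightarrow> ('b \<Rightarrow>\<^sub>0 'k)"
  where "linear_ext h f =
    (\<Sum>s\<in>Poly_Mapping.keys f. Poly_Mapping.single (h s) (Poly_Mapping.lookup f s))"

text \<open>The algebra \<open>k\<Lambda>(S)\<close> appears as the elements of \<open>'s set \<Rightarrow>\<^sub>0 'k\<close> supported on \<open>\<Lambda>(S)\<close>.\<close>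

definition Lambda_alg :: "('s::semigroup_mult set \<Rightarrow>\<^sub>0 'k::comm_ring) set"
  where "Lambda_alg = {g. Poly_Mapping.keys g \<subseteq> Lambda}"

lemma linear_ext_c_map_in_Lambda_alg:
  fixes f :: "'s::{finite, semigroup_mult} \<Rightarrow>\<^sub>0 'k::comm_ring"
  shows "linear_ext c_map f \<in> Lambda_alg"
proof -
  have "Poly_Mapping.keys (linear_ext c_map f) \<subseteq>
      (\<Union>s\<in>Poly_Mapping.keys f. Poly_Mapping.keys
        (Poly_Mapping.single (c_map s) (Poly_Mapping.lookup f s)))"
    unfolding linear_ext_def by (rule keys_sum)
  also have "\<dots> \<subseteq> Lambda"
    using c_map_in_Lambda by (auto split: if_splits)
  finally show ?thesis by (simp add: Lambda_alg_def)
qed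

definition ker_c :: "('s::semigroup_mult \<Rightarrow>\<^sub>0 'k::comm_ring) set"
  where "ker_c = {f. linear_ext c_map f = 0}"

definition ideal_mult ::
    "('s::semigroup_mult \<Rightarrow>\<^sub>0 'k::comm_ring) set \<Rightarrow> ('s \<Rightarrow>\<^sub>0 'k) set \<Rightarrow> ('s \<Rightarrow>\<^sub>0 'k) set"
  where "ideal_mult I J =
    {\<Sum>i<m. alg_mult (f i) (g i) | (m::nat) f g. \<forall>i<m. f i \<in> I \<and> g i \<in> J}"

text \<open>Since \<open>kS\<close> need not be unital, \<open>J\<^sup>1 = J\<close> is a separate clause instead of \<open>J\<^sup>0 J\<close>.\<close>

fun ideal_power ::
    "('s::semigroup_mult \<Rightarrow>\<^sub>0 'k::comm_ring) set \<Rightarrow> nat \<Rightarrow> ('s \<Rightarrow>\<^sub>0 'k) set"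
  where
    "ideal_power J 0 = UNIV"
  | "ideal_power J (Suc 0) = J"
  | "ideal_power J (Suc (Suc n)) = ideal_mult (ideal_power J (Suc n)) J"

end

theory Submission
  imports Defs
begin

text \<open>If \<open>c(a) = c(b)\<close>, then \<open>a\<^sup>\<omega> b\<^sup>\<omega> = a\<^sup>\<omega>\<close>, so in an \<open>\<R>\<close>-trivial semigroup \<open>a\<close> and \<open>b\<close> fix the
  same elements \<open>s\<close> under right multiplication: \<open>sa = s\<close> iff \<open>sa\<^sup>\<omega> = s\<close>. Hence for \<open>f \<in> \<JJ>\<close> the
  coefficient of \<open>s\<close> in \<open>sf\<close> is a sum of coefficients of \<open>c(f) = 0\<close>, and \<open>sf\<close> is supported strictly
  \<open>\<R>\<close>-below \<open>s\<close>. Each further factor from \<open>\<JJ>\<close> thus moves the support one step down, and chains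
  are exhausted after \<open>n + 1\<close> steps.\<close>

lemma R_le_mult: "R_le (s * t) s"
  by (auto simp: R_le_def right_ideal1_def mult.assoc)

lemma R_trivial_antisym:
  fixes s t :: "'s::semigroup_mult"
  assumes "R_trivial TYPE('s)" "R_le s t" "R_le t s"
  shows "s = t"
  using assms unfolding R_trivial_def partial_order_on_def antisym_def by blast

lemma
  fixes s :: "'s::{finite, semigroup_mult}"
  shows idempotent_omega: "idempotent (omega s)"
    and omega_in_range_pow_Suc: "omega s \<in> range (pow_Suc s)"
  using theI'[OF ex1_idempotent_power[of s]] by (simp_all add: omega_def)

lemma mult_pow_Suc_fixed: "s * a = s \<Longrightarrow> s * pow_Suc a n = s"
  by (induction n) (simp_all flip: mult.assoc)

lemma pow_Suc_eq_mult: "pow_Suc a n = a \<or> (\<exists>b. pow_Suc a n = a * b)"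
  by (induction n) (auto simp: mult.assoc)

text \<open>As a power of \<open>a\<close>, \<open>omega a\<close> is \<open>a\<close> or has
  \<open>a\<close> as its left factor. So if \<open>omega a\<close> fixes \<open>s\<close>, then
  \<open>s\<close> is \<R>-below \<open>s * a\<close>, which is \<R>-below \<open>s\<close>, and
  antisymmetry applies.\<close>

lemma mult_omega_eq_iff:
  fixes s a :: "'s::{finite, semigroup_mult}"
  assumes "R_trivial TYPE('s)"
  shows "s * omega a = s \<longleftrightarrow> s * a = s"
proof
  assume fixed: "s * omega a = s"
  obtain n where "omega a = pow_Suc a n"
    using omega_in_range_pow_Suc[of a] by blast
  then consider "omega a = a" | b where "omega a = a * b"
    using pow_Suc_eq_mult[of a n] by auto
  then have "R_le s (s * a)"
  proof cases
    case 1
    then show ?thesis using fixed by (simp add: R_le_def)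
  next
    case (2 b)
    then show ?thesis using fixed R_le_mult[of "s * a" b] by (simp add: mult.assoc)
  qed
  then show "s * a = s"
    by (rule R_trivial_antisym[OF assms R_le_mult])
next
  assume "s * a = s"
  moreover obtain n where "omega a = pow_Suc a n"
    using omega_in_range_pow_Suc[of a] by blast
  ultimately show "s * omega a = s"
    by (simp add: mult_pow_Suc_fixed)
qed

text \<open>An idempotent lies in its own left ideal, and right multiplication by \<open>f\<close>
  fixes every multiple \<open>t * f\<close>.\<close>

lemma left_ideal_eq_mult:
  assumes "idempotent e" "idempotent f" "left_ideal e = left_ideal f"
  shows "e * f = e"
proof -
  have "e \<in> left_ideal e"
    using assms(1) unfolding left_ideal_def idempotent_def by (metis rangeI)
  then obtain t where "e = t * f"
    using assms(3) by (auto simp: left_ideal_def)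
  then show ?thesis
    using assms(2) by (simp add: idempotent_def mult.assoc)
qed

lemma mult_fixed_cong_c_map:
  fixes s a b :: "'s::{finite, semigroup_mult}"
  assumes "R_trivial TYPE('s)" "c_map a = c_map b" "s * a = s"
  shows "s * b = s"
proof -
  have "omega a * omega b = omega a"
    using assms(2) by (intro left_ideal_eq_mult idempotent_omega) (simp add: c_map_def)
  then show ?thesis
    using assms(3) mult_omega_eq_iff[OF assms(1)] by (metis mult.assoc)
qed

lemma lookup_linear_ext:
  "Poly_Mapping.lookup (linear_ext h f) x =
    (\<Sum>t\<in>Poly_Mapping.keys f. if h t = x then Poly_Mapping.lookup f t else 0)"
  by (simp add: linear_ext_def lookup_sum lookup_single when_def)

text \<open>Grouping the terms by their value under \<open>h\<close> turns the sum into a sum of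
  coefficients of \<open>linear_ext h f\<close>.\<close>

lemma sum_preimage_eq_0:
  assumes "linear_ext h f = 0" "finite P"
  shows "(\<Sum>t\<in>Poly_Mapping.keys f. if h t \<in> P then Poly_Mapping.lookup f t else 0) = 0"
proof -
  have "(\<Sum>t\<in>Poly_Mapping.keys f. if h t \<in> P then Poly_Mapping.lookup f t else 0) =
      (\<Sum>t\<in>Poly_Mapping.keys f. \<Sum>x\<in>P. if h t = x then Poly_Mapping.lookup f t else 0)"
    using assms(2) by (simp add: sum.delta)
  also have "\<dots> = (\<Sum>x\<in>P. Poly_Mapping.lookup (linear_ext h f) x)"
    unfolding lookup_linear_ext by (rule sum.swap)
  finally show ?thesis
    using assms(1) by simp
qed

text \<open>The sum is the part of \<open>alg_mult g f\<close> contributed by a single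
  \<open>s\<close> in the support of \<open>g\<close>, with \<open>a\<close> as its
  coefficient.\<close>

lemma keys_mult_ker_c_subset:
  fixes f :: "'s::{finite, semigroup_mult} \<Rightarrow>\<^sub>0 'k::comm_ring"
  assumes R_trivial: "R_trivial TYPE('s)" and f: "f \<in> ker_c"
  shows "Poly_Mapping.keys (\<Sum>t\<in>Poly_Mapping.keys f.
      Poly_Mapping.single (s * t) (a * Poly_Mapping.lookup f t)) \<subseteq> {u. R_less u s}"
    (is "Poly_Mapping.keys ?p \<subseteq> _")
proof
  fix u assume u: "u \<in> Poly_Mapping.keys ?p"
  also have "Poly_Mapping.keys ?p \<subseteq> (\<Union>t\<in>Poly_Mapping.keys f.
      Poly_Mapping.keys (Poly_Mapping.single (s * t) (a * Poly_Mapping.lookup f t)))"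
    by (rule keys_sum)
  finally have "R_le u s"
    by (auto split: if_splits intro: R_le_mult)
  moreover have "u \<noteq> s"
  proof
    assume "u = s"
    define P where "P = c_map ` {t. s * t = s}"
    \<comment> \<open>Whether \<open>t\<close> fixes \<open>s\<close> depends on
      \<open>c_map t\<close> alone, so the preimage of \<open>P\<close> is exactly the set of such
      \<open>t\<close>.\<close>
    have P: "s * t = s \<longleftrightarrow> c_map t \<in> P" for t
      unfolding P_def by (blast dest: mult_fixed_cong_c_map[OF R_trivial sym])
    have "Poly_Mapping.lookup ?p s =
        (\<Sum>t\<in>Poly_Mapping.keys f. a * (if c_map t \<in> P then Poly_Mapping.lookup f t else 0))"
      unfolding lookup_sum lookup_single when_def
      by (rule sum.cong) (auto simp flip: P)
    also have "\<dots> = 0"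
      using sum_preimage_eq_0[of c_map f P] f by (simp add: ker_c_def flip: sum_distrib_left)
    finally show False
      using u \<open>u = s\<close> by (simp add: in_keys_iff)
  qed
  ultimately show "u \<in> {u. R_less u s}"
    by (simp add: R_less_def)
qed

text \<open>Chains ascend with the index, so these are the elements with at least \<open>m\<close>
  strict steps above them.\<close>

definition chain_bottoms :: "nat \<Rightarrow> 's::semigroup_mult set"
  where "chain_bottoms m = {r 0 | r. R_chain r m}"

lemma chain_bottoms_0: "chain_bottoms 0 = UNIV"
  by (auto simp: chain_bottoms_def R_chain_def)

lemma chain_bottoms_Suc:
  assumes "s \<in> chain_bottoms m" "R_less u s"
  shows "u \<in> chain_bottoms (Suc m)"
proof -
  obtain r where "R_chain r m" "s = r 0"
    using assms(1) by (auto simp: chain_bottoms_def)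
  then have "R_chain (case_nat u r) (Suc m)"
    using assms(2) by (auto simp: R_chain_def less_Suc_eq_0_disj split: nat.splits)
  then show ?thesis
    by (auto simp: chain_bottoms_def intro!: exI[of _ "case_nat u r"])
qed

lemma keys_alg_mult_ker_c:
  fixes f g :: "'s::{finite, semigroup_mult} \<Rightarrow>\<^sub>0 'k::comm_ring"
  assumes "R_trivial TYPE('s)" "f \<in> ker_c" "Poly_Mapping.keys g \<subseteq> chain_bottoms m"
  shows "Poly_Mapping.keys (alg_mult g f) \<subseteq> chain_bottoms (Suc m)"
proof -
  have "Poly_Mapping.keys (alg_mult g f) \<subseteq> (\<Union>s\<in>Poly_Mapping.keys g. {u. R_less u s})"
    unfolding alg_mult_def
    by (rule order_trans[OF keys_sum UN_mono[OF order_refl keys_mult_ker_c_subset[OF assms(1,2)]]])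
  then show ?thesis
    using assms(3) chain_bottoms_Suc by blast
qed

text \<open>The leftmost factor may have any support; only the \<open>m\<close> factors multiplied
  on its right push the support down, whence the shift by one.\<close>

lemma keys_ideal_power_ker_c:
  fixes f :: "'s::{finite, semigroup_mult} \<Rightarrow>\<^sub>0 'k::comm_ring"
  assumes "R_trivial TYPE('s)" "f \<in> ideal_power ker_c (Suc m)"
  shows "Poly_Mapping.keys f \<subseteq> chain_bottoms m"
  using assms(2)
proof (induction m arbitrary: f)
  case 0
  then show ?case by (simp add: chain_bottoms_0)
next
  case (Suc m)
  then obtain l :: nat and g h where f: "f = (\<Sum>i<l. alg_mult (g i) (h i))"
    and gh: "\<And>i. i < l \<Longrightarrow> g i \<in> ideal_power ker_c (Suc m) \<and> h i \<in> ker_c"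
    by (auto simp: ideal_mult_def)
  have "Poly_Mapping.keys f \<subseteq> (\<Union>i<l. Poly_Mapping.keys (alg_mult (g i) (h i)))"
    unfolding f by (rule keys_sum)
  also have "\<dots> \<subseteq> chain_bottoms (Suc m)"
    using gh by (intro UN_least keys_alg_mult_ker_c[OF assms(1)] Suc.IH) simp_all
  finally show ?case .
qed

theorem theorem3p1:
  fixes n :: nat
  assumes R_trivial: "R_trivial TYPE('s::{finite, semigroup_mult})"
    and right_unit: "\<And>s :: 's. s \<in> range ((*) s)"
    and chain: "\<exists>s :: nat \<Rightarrow> 's. R_chain s n"
    and longest: "\<And>m (s :: nat \<Rightarrow> 's). R_chain s m \<Longrightarrow> m \<le> n"
  shows "ideal_power (ker_c :: ('s \<Rightarrow>\<^sub>0 'k::{comm_ring, comm_monoid_mult}) set) (n + 2) = {0}"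
proof -
  \<comment> \<open>A product of \<open>n + 2\<close> factors is supported on bottoms of chains of
    length \<open>n + 1\<close>, and no such chain exists.\<close>
  have "chain_bottoms (Suc n) = ({} :: 's set)"
    using longest by (fastforce simp: chain_bottoms_def)
  then have "f = 0" if "f \<in> ideal_power (ker_c :: ('s \<Rightarrow>\<^sub>0 'k) set) (n + 2)" for f
    using keys_ideal_power_ker_c[OF R_trivial, of f "Suc n"] that by simp
  \<comment> \<open>Zero is the empty sum of products.\<close>
  moreover have "0 \<in> ideal_power (ker_c :: ('s \<Rightarrow>\<^sub>0 'k) set) (n + 2)"
    by (auto simp: ideal_mult_def intro!: exI[of _ "0::nat"])
  ultimately show ?thesis by blast
qed

end
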